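(* Let $n,m\in\mathbb{N}$, $0\le a\le n$, $0\le b\le m$ and $0\le k\le n+m$. Let $\mathfrak{I}:\mathbb{X}_n\times\mathbb{X}_n\to\mathbb{R}$ be an $n$-symmetric kernel, $\mathfrak{L}:\mathbb{Y}_m\times\mathbb{Y}_m\to\mathbb{R}$ an $m$-symmetric kernel, and consider the $(n+m)$-symmetric kernel $\mathfrak{I}\times\mathfrak{L}$ on $\mathbb{X}_n\times\mathbb{Y}_m$. Then: (i) The kernel $\mathfrak{I}\times\mathfrak{L}$ is $\mathrm{SPDI}_k$ in $\mathbb{X}_n\times\mathbb{Y}_m$ if and only if, for some $\ell\in\{0,1\}$, $(-1)^{a'+k+\ell}\mathfrak{I}$ is $\mathrm{SPDI}_{a'}$ in $\mathbb{X}_n$ and $(-1)^{b'+\ell}\mathfrak{L}$ is $\mathrm{SPDI}_{b'}$ in $\mathbb{Y}_m$, where $a'=\max(k-m,0)$ and $b'=\max(k-n,0)$. (ii) If for some $\ell\in\{0,1\}$ the kernel $(-1)^\ell\mathfrak{I}$ is $\mathrm{SPDI}_a$ in $\mathbb{X}_n$ and $(-1)^\ell\mathfrak{L}$ is $\mathrm{SPDI}_b$ in $\mathbb{Y}_m$, then $(-1)^{k'+a+b}\,\mathfrak{I}\times\mathfrak{L}$ is $\mathrm{SPDI}_{k'}$ in $\mathbb{X}_n\times\mathbb{Y}_m$, where $k'=\max\big((a+m)\operatorname{sgn}(a),(n+b)\operatorname{sgn}(b)\big)$. The converse holds when $(a+m)\operatorname{sgn}(a)=(n+b)\operatorname{sgn}(b)$.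 (iii) For $k\le\min\{n,m\}$, the kernel $\mathfrak{I}\times\mathfrak{L}$ is $\mathrm{SPDI}_k$ in $\mathbb{X}_n\times\mathbb{Y}_m$ if and only if $(-1)^k\,\mathfrak{I}\times\mathfrak{L}$ is SPD in $\mathbb{X}_n\times\mathbb{Y}_m$, which is also equivalent to $(-1)^{k+\ell}\mathfrak{I}$ being SPD in $\mathbb{X}_n$ and $(-1)^\ell\mathfrak{L}$ being SPD in $\mathbb{Y}_m$ for some $\ell\in\{0,1\}$.
   Context: $X_1,\dots,X_n,Y_1,\dots,Y_m$ are nonempty sets; $\mathbb{X}_n=\prod_{i=1}^nX_i$, $\mathbb{Y}_m=\prod_{j=1}^mY_j$; $\mathbb{X}_n\times\mathbb{Y}_m$ is regarded as an $(n+m)$-fold Cartesian product. $(\mathfrak{I}\times\mathfrak{L})((x,y),(x',y'))=\mathfrak{I}(x,x')\mathfrak{L}(y,y')$. $\operatorname{sgn}(r)=1$ for $r>0$, $\operatorname{sgn}(r)=-1$ for $r<0$, $\operatorname{sgn}(0)=0$. For an $N$-fold product $\mathbb{Z}_N=\prod_{i=1}^NZ_i$: $\mathcal{M}(\mathbb{Z}_N)$ is the space of discrete (finitely supported) real signed measures, and for $0\le k\le N$, $\mathcal{M}_k(\mathbb{Z}_N)$ is the set of $\mu\in\mathcal{M}(\mathbb{Z}_N)$ with $\mu(\prod_iA_i)=0$ whenever $A_i\subset Z_i$ and $|\{i:A_i=Z_i\}|\ge N-k+1$. A kernel on $\mathbb{Z}_N$ is $N$-symmetric if its value at a pair $(x_{\vec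 1},x_{\vec 2})$ is unchanged when, for any set of indices $i$, the $i$-th coordinates of $x_{\vec 1}$ and $x_{\vec 2}$ are interchanged. An $N$-symmetric kernel $\mathfrak{T}$ is $\mathrm{SPDI}_k$ in $\mathbb{Z}_N$ if $\iint(-1)^k\mathfrak{T}(u,v)\,d\mu(u)d\mu(v)\ge0$ for all $\mu\in\mathcal{M}_k(\mathbb{Z}_N)$, with equality only for $\mu=0$. SPD means strictly positive definite: $\iint\mathfrak{T}\,d\mu\,d\mu>0$ for every nonzero finitely supported signed measure $\mu$ (equivalently $\mathrm{SPDI}_0$ for $N$-symmetric kernels).
   Formalization: In (i) "only if", the converse in (ii), and "SPDI_k implies SPD" in (iii), when the order (k, resp. k') is positive, every X_i and Y_j is assumed to have at least two points; with singleton factors these implications can fail (n=m=k=1, singletons, I=L=1). *)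

theory Defs
  imports Complex_Main "HOL-Library.FuncSet"
begin

text \<open>
  An \<open>N\<close>-fold product is \<open>PiE {..<N} Z\<close> for a family \<open>Z\<close> of subsets of one type; arbitrary factors
  embed into a common type by a disjoint sum.  A kernel on the product is a total function of
  which only the values on \<open>PiE {..<N} Z\<close> matter.  A finitely supported signed measure is
  represented by its point masses.
\<close>

definition support :: "('z \<Rightarrow> real) \<Rightarrow> 'z set" where
  "support \<mu> = {z. \<mu> z \<noteq> 0}"

definition discrete_measures :: "nat \<Rightarrow> (nat \<Rightarrow> 'a set) \<Rightarrow> ((nat \<Rightarrow> 'a) \<Rightarrow> real) set" where
  "discrete_measures N Z = {\<mu>. finite (support \<mu>) \<and> support \<mu> \<subseteq> PiE {..<N} Z}"

definition mass :: "('z \<Rightarrow> real) \<Rightarrow> 'z set \<Rightarrow> real" where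
  "mass \<mu> A = (\<Sum>z\<in>support \<mu> \<inter> A. \<mu> z)"

text \<open>The subtraction below is meant for \<open>k \<le> N\<close> only.\<close>

definition measures_order :: "nat \<Rightarrow> nat \<Rightarrow> (nat \<Rightarrow> 'a set) \<Rightarrow> ((nat \<Rightarrow> 'a) \<Rightarrow> real) set" where
  "measures_order k N Z =
    {\<mu> \<in> discrete_measures N Z.
       \<forall>A. (\<forall>i<N. A i \<subseteq> Z i) \<and> card {i. i < N \<and> A i = Z i} \<ge> N - k + 1
         \<longrightarrow> mass \<mu> (PiE {..<N} A) = 0}"

definition double_integral :: "('z \<Rightarrow> 'z \<Rightarrow> real) \<Rightarrow> ('z \<Rightarrow> real) \<Rightarrow> real" where
  "double_integral T \<mu> = (\<Sum>u\<in>support \<mu>. \<Sum>v\<in>support \<mu>. T u v * \<mu> u * \<mu> v)"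

definition multi_symmetric ::
    "nat \<Rightarrow> (nat \<Rightarrow> 'a set) \<Rightarrow> ((nat \<Rightarrow> 'a) \<Rightarrow> (nat \<Rightarrow> 'a) \<Rightarrow> real) \<Rightarrow> bool" where
  "multi_symmetric N Z T \<longleftrightarrow>
    (\<forall>u\<in>PiE {..<N} Z. \<forall>v\<in>PiE {..<N} Z. \<forall>J\<subseteq>{..<N}.
       T (override_on u v J) (override_on v u J) = T u v)"

definition SPDI ::
    "nat \<Rightarrow> nat \<Rightarrow> (nat \<Rightarrow> 'a set) \<Rightarrow> ((nat \<Rightarrow> 'a) \<Rightarrow> (nat \<Rightarrow> 'a) \<Rightarrow> real) \<Rightarrow> bool" where
  "SPDI k N Z T \<longleftrightarrow> multi_symmetric N Z T \<and>
    (\<forall>\<mu>\<in>measures_order k N Z.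
       double_integral (\<lambda>u v. (-1) ^ k * T u v) \<mu> \<ge> 0 \<and>
       (double_integral (\<lambda>u v. (-1) ^ k * T u v) \<mu> = 0 \<longrightarrow> \<mu> = (\<lambda>_. 0)))"

definition SPD ::
    "nat \<Rightarrow> (nat \<Rightarrow> 'a set) \<Rightarrow> ((nat \<Rightarrow> 'a) \<Rightarrow> (nat \<Rightarrow> 'a) \<Rightarrow> real) \<Rightarrow> bool" where
  "SPD N Z T \<longleftrightarrow>
    (\<forall>\<mu>\<in>discrete_measures N Z. \<mu> \<noteq> (\<lambda>_. 0) \<longrightarrow> double_integral T \<mu> > 0)"

text \<open>
  The product of an \<open>n\<close>-fold and an \<open>m\<close>-fold product is the \<open>(n+m)\<close>-fold product of the
  concatenated family; a point \<open>z\<close> of it stands for the pair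
  \<open>(first_part n z, second_part n m z)\<close>.
\<close>

definition concat_family :: "nat \<Rightarrow> (nat \<Rightarrow> 'a set) \<Rightarrow> (nat \<Rightarrow> 'a set) \<Rightarrow> nat \<Rightarrow> 'a set" where
  "concat_family n X Y = (\<lambda>i. if i < n then X i else Y (i - n))"

definition first_part :: "nat \<Rightarrow> (nat \<Rightarrow> 'a) \<Rightarrow> nat \<Rightarrow> 'a" where
  "first_part n z = restrict z {..<n}"

definition second_part :: "nat \<Rightarrow> nat \<Rightarrow> (nat \<Rightarrow> 'a) \<Rightarrow> nat \<Rightarrow> 'a" where
  "second_part n m z = restrict (\<lambda>j. z (n + j)) {..<m}"

definition prod_kernel ::
    "nat \<Rightarrow> nat \<Rightarrow> ((nat \<Rightarrow> 'a) \<Rightarrow> (nat \<Rightarrow> 'a) \<Rightarrow> real) \<Rightarrow> ((nat \<Rightarrow> 'a) \<Rightarrow> (nat \<Rightarrow> 'a) \<Rightarrow> real)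
      \<Rightarrow> (nat \<Rightarrow> 'a) \<Rightarrow> (nat \<Rightarrow> 'a) \<Rightarrow> real" where
  "prod_kernel n m I L = (\<lambda>z z'.
     I (first_part n z) (first_part n z') * L (second_part n m z) (second_part n m z'))"

text \<open>
  For \<open>k > 0\<close> and factors that may be singletons, the order-\<open>k\<close> measures can be too few for the
  \<open>SPDI\<close> property of a product kernel to constrain its two factors.  With all factors singletons
  and \<open>0 < k\<close>, the zero measure is the only one of order \<open>k\<close>, so every
  \<open>N\<close>-symmetric kernel is \<open>SPDI\<close> of
  order \<open>k\<close>.
\<close>

definition nonsingleton_factors :: "nat \<Rightarrow> (nat \<Rightarrow> 'a set) \<Rightarrow> bool" where
  "nonsingleton_factors N Z \<longleftrightarrow> (\<forall>i<N. \<exists>x\<in>Z i. \<exists>y\<in>Z i. x \<noteq> y)"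

end

theory Submission
  imports Defs
begin

text \<open>
  A measure of order \<open>k\<close> on the product, read as a matrix indexed by the two parts, has its columns in
  the measures of order \<open>k - m\<close> on the first space and its rows in those of order \<open>k - n\<close> on the second.
  Two forms that are positive definite on these spaces have a tensor product that is positive definite
  on such matrices.  Conversely, testing the product kernel on \<open>\<mu> \<otimes> \<nu>\<close>, where \<open>\<mu>\<close> has order \<open>p\<close>, \<open>\<nu>\<close> has
  order \<open>q\<close> and \<open>p + q \<ge> k\<close>, and fixing one factor to be a nonzero measure of top order
  (any nonzero measure if \<open>k = 0\<close>), shows that each kernel has a constant strict sign; the two signs are compared on the fixed measures.
\<close>

section \<open>Tensor products of positive definite forms\<close>

text \<open>The index set \<open>S\<close> is fixed and the two arguments are separate, whereas the
  range of \<open>double_integral\<close> varies with the measure. This makes the form literally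
  bilinear.\<close>

definition form :: "'z set \<Rightarrow> ('z \<Rightarrow> 'z \<Rightarrow> real) \<Rightarrow> ('z \<Rightarrow> real) \<Rightarrow> ('z \<Rightarrow> real) \<Rightarrow> real" where
  "form S T f g = (\<Sum>u\<in>S. \<Sum>v\<in>S. T u v * f u * g v)"

lemma form_commute:
  assumes "\<And>u v. u \<in> S \<Longrightarrow> v \<in> S \<Longrightarrow> T u v = T v u"
  shows "form S T f g = form S T g f"
proof -
  have "form S T f g = (\<Sum>v\<in>S. \<Sum>u\<in>S. T u v * f u * g v)"
    unfolding form_def by (rule sum.swap)
  also have "\<dots> = form S T g f"
    unfolding form_def using assms by (intro sum.cong) (auto simp: mult_ac)
  finally show ?thesis .
qed

lemma form_add_left: "form S T (\<lambda>z. f z + c * g z) h = form S T f h + c * form S T g h"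
  by (simp add: form_def algebra_simps sum.distrib sum_distrib_left)

lemma form_add_right: "form S T h (\<lambda>z. f z + c * g z) = form S T h f + c * form S T h g"
  by (simp add: form_def algebra_simps sum.distrib sum_distrib_left)

text \<open>Each step splits off the orthogonal projection of all columns onto one nonzero column.\<close>

lemma tensor_form_pos:
  fixes I :: "'x \<Rightarrow> 'x \<Rightarrow> real" and L :: "'y \<Rightarrow> 'y \<Rightarrow> real"
  assumes "finite T"
    and sym: "\<And>x x'. x \<in> S \<Longrightarrow> x' \<in> S \<Longrightarrow> I x x' = I x' x"
    and V_diff: "\<And>f g c. f \<in> V \<Longrightarrow> g \<in> V \<Longrightarrow> (\<lambda>x. f x - c * g x) \<in> V"
    and W_diff: "\<And>f g c. f \<in> W \<Longrightarrow> g \<in> W \<Longrightarrow> (\<lambda>y. f y - c * g y) \<in> W"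
    and W_sum: "\<And>r g. (\<And>x. x \<in> S \<Longrightarrow> g x \<in> W) \<Longrightarrow> (\<lambda>y. \<Sum>x\<in>S. r x * g x y) \<in> W"
    and V_pos: "\<And>f. f \<in> V \<Longrightarrow> f \<noteq> (\<lambda>_. 0) \<Longrightarrow> form S I f f > 0"
    and W_pos: "\<And>g. g \<in> W \<Longrightarrow> g \<noteq> (\<lambda>_. 0) \<Longrightarrow> form T L g g > 0"
    and "\<And>y. (\<lambda>x. F x y) \<in> V" "\<And>x. F x \<in> W" "\<And>x y. y \<notin> T \<Longrightarrow> F x y = 0"
    and "F x0 y0 \<noteq> 0"
  shows "(\<Sum>y\<in>T. \<Sum>y'\<in>T. L y y' * form S I (\<lambda>x. F x y) (\<lambda>x. F x y')) > 0"
  using assms(8-)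
\<comment> \<open>Columns of \<open>F\<close> are indexed by \<open>y\<close>. The induction is on
  the number of nonzero columns: the projection kills column \<open>y0\<close> and leaves zero
  columns zero.\<close>
proof (induction "card {y \<in> T. \<exists>x. F x y \<noteq> 0}" arbitrary: F x0 y0 rule: less_induct)
  case less
  define e where "e = (\<lambda>x. F x y0)"
  define E where "E = form S I e e"
  \<comment> \<open>\<open>c y\<close> is the coefficient of column \<open>y\<close> along
    \<open>e\<close> with respect to \<open>I\<close>, so the columns of \<open>F'\<close> are
    orthogonal to \<open>e\<close>.\<close>
  define c where "c = (\<lambda>y. form S I e (\<lambda>x. F x y) / E)"
  define F' where "F' = (\<lambda>x y. F x y - c y * e x)"
  have "e \<in> V" and e0: "e x0 \<noteq> 0"
    using less.prems by (auto simp: e_def)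
  then have "E > 0"
    using V_pos[of e] by (auto simp: E_def)
  have "y0 \<in> T"
    using less.prems(3,4) by blast
  have "c y0 = 1"
    using \<open>E > 0\<close> by (simp add: c_def E_def e_def)
  \<comment> \<open>Pairing every column with \<open>e\<close> amounts to a linear combination of
    the rows of \<open>F\<close>, which puts \<open>c\<close> into \<open>W\<close>.\<close>
  have c_eq: "c = (\<lambda>y. \<Sum>x\<in>S. ((\<Sum>u\<in>S. I u x * e u) / E) * F x y)"
  proof
    fix y
    have "form S I e (\<lambda>x. F x y) = (\<Sum>x\<in>S. \<Sum>u\<in>S. I u x * e u * F x y)"
      unfolding form_def by (rule sum.swap)
    then show "c y = (\<Sum>x\<in>S. ((\<Sum>u\<in>S. I u x * e u) / E) * F x y)"
      by (simp add: c_def sum_divide_distrib sum_distrib_right)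
  qed
  have "c \<in> W"
    unfolding c_eq by (rule W_sum) (rule less.prems(2))
  then have cpos: "form T L c c > 0"
    using W_pos \<open>c y0 = 1\<close> by (metis zero_neq_one)
  have F_split: "(\<lambda>x. F x y) = (\<lambda>x. F' x y + c y * e x)" for y
    by (simp add: F'_def)
  have orth: "form S I e (\<lambda>x. F' x y) = 0" for y
  proof -
    have "form S I e (\<lambda>x. F x y) = form S I e (\<lambda>x. F' x y) + c y * E"
      unfolding E_def by (subst F_split, rule form_add_right)
    then show ?thesis
      using \<open>E > 0\<close> by (simp add: c_def)
  qed
  then have orth': "form S I (\<lambda>x. F' x y) e = 0" for y
    using form_commute[of S I, OF sym] by metis
  \<comment> \<open>Pythagoras: the Gram matrix of the columns is that of \<open>F'\<close> plus a
    rank-one matrix, which contributes \<open>E * form T L c c\<close> to the double sum.\<close>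
  have "form S I (\<lambda>x. F x y) (\<lambda>x. F x y') =
      form S I (\<lambda>x. F' x y) (\<lambda>x. F' x y') + c y * c y' * E" for y y'
    unfolding F_split[of y] F_split[of y'] form_add_left form_add_right orth orth' E_def by simp
  then have split: "(\<Sum>y\<in>T. \<Sum>y'\<in>T. L y y' * form S I (\<lambda>x. F x y) (\<lambda>x. F x y')) =
      (\<Sum>y\<in>T. \<Sum>y'\<in>T. L y y' * form S I (\<lambda>x. F' x y) (\<lambda>x. F' x y')) + E * form T L c c"
    by (simp add: algebra_simps sum.distrib sum_distrib_left form_def[of T])
  \<comment> \<open>The rank-one term is already strictly positive, so a nonnegative remainder
    suffices; this covers the case where \<open>F'\<close> vanishes and the induction stops.\<close>
  have "(\<Sum>y\<in>T. \<Sum>y'\<in>T. L y y' * form S I (\<lambda>x. F' x y) (\<lambda>x. F' x y')) \<ge> 0"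
  proof (cases "\<exists>x y. F' x y \<noteq> 0")
    case True
    then obtain x1 y1 where ne: "F' x1 y1 \<noteq> 0"
      by blast
    have off: "F' x y = 0" if "y \<notin> T" for x y
      using less.prems(3)[OF that] by (simp add: F'_def c_def form_def)
    have zero: "F' x y = 0" if "\<And>x. F x y = 0" for x y
      using that by (simp add: F'_def c_def form_def)
    have "F' x y0 = 0" for x
      using \<open>c y0 = 1\<close> by (simp add: F'_def e_def)
    then have "{y \<in> T. \<exists>x. F' x y \<noteq> 0} \<subset> {y \<in> T. \<exists>x. F x y \<noteq> 0}"
      using zero \<open>y0 \<in> T\<close> e0 unfolding e_def by blast
    then have "card {y \<in> T. \<exists>x. F' x y \<noteq> 0} < card {y \<in> T. \<exists>x. F x y \<noteq> 0}"
      using \<open>finite T\<close> by (intro psubset_card_mono) auto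
    moreover have "(\<lambda>x. F' x y) \<in> V" for y
      unfolding F'_def using V_diff less.prems(1) \<open>e \<in> V\<close> by blast
    moreover have "F' x \<in> W" for x
    proof -
      have "F' x = (\<lambda>y. F x y - e x * c y)"
        by (simp add: F'_def mult.commute)
      then show ?thesis
        using W_diff[OF less.prems(2) \<open>c \<in> W\<close>] by simp
    qed
    ultimately show ?thesis
      using less.hyps[of F' x1 y1] off ne by (meson less_imp_le)
  next
    case False
    then show ?thesis
      by (simp add: form_def)
  qed
  then show ?case
    using split cpos \<open>E > 0\<close> by (simp add: add_nonneg_pos)
qed

section \<open>Measures of a given order\<close>

text \<open>Points off the support add nothing, so different measures can be summed over one common
  finite set.\<close>

lemma mass_eq_sum:
  assumes "finite S" "support \<mu> \<subseteq> S"
  shows "mass \<mu> A = (\<Sum>z\<in>S \<inter> A. \<mu> z)"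
  unfolding mass_def using assms by (intro sum.mono_neutral_left) (auto simp: support_def)

lemma double_integral_eq_form:
  assumes "finite S" "support \<mu> \<subseteq> S"
  shows "double_integral T \<mu> = form S T \<mu> \<mu>"
proof -
  have "(\<Sum>v\<in>support \<mu>. T u v * \<mu> u * \<mu> v) = (\<Sum>v\<in>S. T u v * \<mu> u * \<mu> v)" for u
    using assms by (intro sum.mono_neutral_left) (auto simp: support_def)
  then show ?thesis
    unfolding double_integral_def form_def using assms
    by (simp, intro sum.mono_neutral_left) (auto simp: support_def)
qed

lemma double_integral_scale: "double_integral (\<lambda>u v. c * T u v) \<mu> = c * double_integral T \<mu>"
  by (simp add: double_integral_def sum_distrib_left mult_ac)

lemma double_integral_zero [simp]: "double_integral T (\<lambda>_. 0) = 0"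
  by (simp add: double_integral_def support_def)

lemma measures_orderD:
  assumes "\<mu> \<in> measures_order k N Z"
  shows "finite (support \<mu>)" "support \<mu> \<subseteq> PiE {..<N} Z"
    and "(\<And>i. i < N \<Longrightarrow> A i \<subseteq> Z i) \<Longrightarrow> card {i. i < N \<and> A i = Z i} \<ge> N - k + 1 \<Longrightarrow>
      mass \<mu> (PiE {..<N} A) = 0"
proof -
  from assms have D: "\<mu> \<in> discrete_measures N Z"
    and M: "\<forall>A. (\<forall>i<N. A i \<subseteq> Z i) \<and> card {i. i < N \<and> A i = Z i} \<ge> N - k + 1 \<longrightarrow>
      mass \<mu> (PiE {..<N} A) = 0"
    unfolding measures_order_def mem_Collect_eq by (rule conjunct1, rule conjunct2)
  show "finite (support \<mu>)" "support \<mu> \<subseteq> PiE {..<N} Z"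
    using D by (simp_all add: discrete_measures_def)
  show "mass \<mu> (PiE {..<N} A) = 0"
    if "\<And>i. i < N \<Longrightarrow> A i \<subseteq> Z i" "card {i. i < N \<and> A i = Z i} \<ge> N - k + 1"
    using M[rule_format, of A] that by simp
qed

lemma measures_orderI:
  assumes "finite (support \<mu>)" "support \<mu> \<subseteq> PiE {..<N} Z"
    and "\<And>A. (\<And>i. i < N \<Longrightarrow> A i \<subseteq> Z i) \<Longrightarrow> card {i. i < N \<and> A i = Z i} \<ge> N - k + 1 \<Longrightarrow>
      mass \<mu> (PiE {..<N} A) = 0"
  shows "\<mu> \<in> measures_order k N Z"
  using assms by (simp add: measures_order_def discrete_measures_def)

lemma card_bounded_nat_le: "card {i. i < N \<and> P i} \<le> (N::nat)"
  using card_mono[of "{..<N}" "{i. i < N \<and> P i}"] by auto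

text \<open>At order 0 the threshold is \<open>N + 1\<close>, more than the number of factors, so no
  box is tested.\<close>

lemma measures_order_0: "measures_order 0 N Z = discrete_measures N Z"
proof -
  have "\<not> card {i. i < N \<and> A i = Z i} \<ge> N - 0 + 1" for A
    using card_bounded_nat_le[of N "\<lambda>i. A i = Z i"] by simp
  then show ?thesis
    by (auto simp: measures_order_def)
qed

text \<open>A higher order lowers the threshold and so tests at least as many boxes.\<close>

lemma measures_order_antimono:
  assumes "p \<le> q"
  shows "measures_order q N Z \<subseteq> measures_order p N Z"
proof -
  have "N - q + 1 \<le> c" if "N - p + 1 \<le> c" for c
    using that assms by linarith
  then show ?thesis
    unfolding measures_order_def by blast
qed

text \<open>Summed over the union of the supports, mass is linear in the measure, so the vanishing
  conditions pass to linear combinations.\<close>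

lemma measures_order_sum:
  assumes "finite J" and g: "\<And>j. j \<in> J \<Longrightarrow> g j \<in> measures_order k N Z"
  shows "(\<lambda>z. \<Sum>j\<in>J. r j * g j z) \<in> measures_order k N Z"
proof -
  define S where "S = (\<Union>j\<in>J. support (g j))"
  define \<mu> where "\<mu> = (\<lambda>z. \<Sum>j\<in>J. r j * g j z)"
  have "finite S"
    using assms measures_orderD(1) unfolding S_def by blast
  have S: "support \<mu> \<subseteq> S"
  proof
    fix z assume "z \<in> support \<mu>"
    then have "\<exists>j\<in>J. r j * g j z \<noteq> 0"
      unfolding \<mu>_def support_def by (auto intro: ccontr sum.neutral)
    then show "z \<in> S"
      by (auto simp: S_def support_def)
  qed
  have "mass \<mu> B = (\<Sum>j\<in>J. r j * mass (g j) B)" for B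
  proof -
    have "mass (g j) B = (\<Sum>z\<in>S \<inter> B. g j z)" if "j \<in> J" for j
      using that \<open>finite S\<close> by (intro mass_eq_sum) (auto simp: S_def)
    then have "(\<Sum>j\<in>J. r j * mass (g j) B) = (\<Sum>j\<in>J. \<Sum>z\<in>S \<inter> B. r j * g j z)"
      by (simp add: sum_distrib_left)
    also have "\<dots> = mass \<mu> B"
      unfolding mass_eq_sum[OF \<open>finite S\<close> S] unfolding \<mu>_def by (rule sum.swap)
    finally show ?thesis ..
  qed
  moreover have "S \<subseteq> PiE {..<N} Z"
    using measures_orderD(2)[OF g] by (auto simp: S_def)
  ultimately have "\<mu> \<in> measures_order k N Z"
    using S \<open>finite S\<close> measures_orderD(3)[OF g]
    by (intro measures_orderI) (auto intro: finite_subset)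
  then show ?thesis
    unfolding \<mu>_def .
qed

lemma measures_order_diff:
  assumes "f \<in> measures_order k N Z" "g \<in> measures_order k N Z"
  shows "(\<lambda>z. f z - c * g z) \<in> measures_order k N Z"
proof -
  \<comment> \<open>The difference is a combination indexed by the two booleans.\<close>
  have "(\<lambda>z. \<Sum>j\<in>UNIV. (if j then 1 else - c) * (if j then f else g) z) \<in> measures_order k N Z"
    using assms by (intro measures_order_sum) auto
  then show ?thesis
    by (simp add: UNIV_bool)
qed

lemma support_diff: "support (\<lambda>z. f z - c * g z) \<subseteq> support f \<union> support g"
  by (auto simp: support_def)

section \<open>Zero and nonzero measures of a given order\<close>

lemma zero_in_measures_order: "(\<lambda>_. 0) \<in> measures_order k N Z"
  by (rule measures_orderI) (auto simp: support_def mass_def)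

text \<open>At order 0 a point mass suffices, so singleton factors are allowed.\<close>

lemma exists_discrete_measure:
  assumes "\<And>i. i < N \<Longrightarrow> Z i \<noteq> {}"
  shows "\<exists>\<mu>\<in>measures_order 0 N Z. \<mu> \<noteq> (\<lambda>_. 0)"
proof -
  obtain z where "z \<in> PiE {..<N} Z"
    using assms by (metis PiE_eq_empty_iff ex_in_conv lessThan_iff)
  then have "(\<lambda>w. if w = z then 1 else 0) \<in> measures_order 0 N Z"
    by (auto simp: measures_order_0 discrete_measures_def support_def)
  moreover have "(\<lambda>w. if w = z then 1 else (0::real)) \<noteq> (\<lambda>_. 0)"
    by (auto simp: fun_eq_iff)
  ultimately show ?thesis
    by blast
qed

text \<open>The witness is the product of the measures \<open>\<delta>\<^sub>x - \<delta>\<^sub>y\<close> with \<open>x \<noteq> y\<close> in each factor.\<close>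

lemma exists_measure_top_order:
  assumes "nonsingleton_factors N Z"
  shows "\<exists>\<mu>\<in>measures_order N N Z. \<mu> \<noteq> (\<lambda>_. 0)"
proof -
  from assms have "\<forall>i. \<exists>x y. i < N \<longrightarrow> x \<in> Z i \<and> y \<in> Z i \<and> x \<noteq> y"
    unfolding nonsingleton_factors_def by blast
  then obtain x y where xy: "\<And>i. i < N \<Longrightarrow> x i \<in> Z i" "\<And>i. i < N \<Longrightarrow> y i \<in> Z i"
      "\<And>i. i < N \<Longrightarrow> x i \<noteq> y i"
    by metis
  define S where "S = PiE {..<N} (\<lambda>i. {x i, y i})"
  \<comment> \<open>On \<open>S\<close> only the arguments \<open>x i\<close> and \<open>y i\<close>
    occur, with weights 1 and -1 that cancel over a full factor.\<close>
  define s where "s = (\<lambda>i t. if t = x i then 1 else (- 1 :: real))"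
  define \<mu> where "\<mu> = (\<lambda>z. if z \<in> S then \<Prod>i<N. s i (z i) else 0)"
  have "finite S"
    unfolding S_def by (intro finite_PiE) auto
  have supp: "support \<mu> \<subseteq> S"
    by (auto simp: support_def \<mu>_def)
  have "S \<subseteq> PiE {..<N} Z"
    unfolding S_def using xy by (intro PiE_mono) auto
  have "\<mu> \<in> measures_order N N Z"
  proof (rule measures_orderI)
    show "finite (support \<mu>)" "support \<mu> \<subseteq> PiE {..<N} Z"
      using supp \<open>finite S\<close> \<open>S \<subseteq> PiE {..<N} Z\<close> by (auto intro: finite_subset)
  next
    fix A assume "\<And>i. i < N \<Longrightarrow> A i \<subseteq> Z i" and "card {i. i < N \<and> A i = Z i} \<ge> N - N + 1"
    \<comment> \<open>At top order the threshold is 1, so a single full factor must force mass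
      zero.\<close>
    then obtain i where i: "i < N" "A i = Z i"
      by (metis (mono_tags, lifting) card.empty diff_self_eq_0 add_0 empty_Collect_eq not_one_le_zero)
    have "mass \<mu> (PiE {..<N} A) = (\<Sum>z\<in>S \<inter> PiE {..<N} A. \<Prod>i<N. s i (z i))"
      unfolding mass_eq_sum[OF \<open>finite S\<close> supp] by (intro sum.cong) (auto simp: \<mu>_def)
    also have "S \<inter> PiE {..<N} A = PiE {..<N} (\<lambda>i. {x i, y i} \<inter> A i)"
      unfolding S_def by (auto simp: PiE_def Pi_def)
    \<comment> \<open>Product weights on a product set: the sum factorizes over the coordinates, and
      the full factor contributes 1 - 1.\<close>
    also have "(\<Sum>z\<in>\<dots>. \<Prod>i<N. s i (z i)) = (\<Prod>i<N. \<Sum>t\<in>{x i, y i} \<inter> A i. s i t)"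
      by (rule prod_sum_PiE[symmetric]) auto
    also have "\<dots> = 0"
    proof (rule prod_zero)
      have "{x i, y i} \<inter> A i = {x i, y i}"
        using xy i by auto
      then show "\<exists>i\<in>{..<N}. (\<Sum>t\<in>{x i, y i} \<inter> A i. s i t) = 0"
        using xy(3)[OF i(1)] i(1) by (intro bexI[of _ i]) (auto simp: s_def)
    qed simp
    finally show "mass \<mu> (PiE {..<N} A) = 0" .
  qed
  moreover have "\<mu> (restrict x {..<N}) \<noteq> 0"
    by (auto simp: \<mu>_def S_def s_def)
  ultimately show ?thesis
    by (metis (mono_tags))
qed

section \<open>Products of two spaces\<close>

text \<open>Inverse of the pair \<open>first_part\<close>, \<open>second_part\<close>. The
  restriction makes the result extensional, as membership in \<open>PiE\<close> demands.\<close>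

definition join :: "nat \<Rightarrow> nat \<Rightarrow> (nat \<Rightarrow> 'a) \<Rightarrow> (nat \<Rightarrow> 'a) \<Rightarrow> nat \<Rightarrow> 'a" where
  "join n m x y = restrict (\<lambda>i. if i < n then x i else y (i - n)) {..<n + m}"

text \<open>From \<open>n\<close> on both sides are \<open>undefined\<close>, because points of
  \<open>PiE\<close> are extensional.\<close>

lemma first_part_join:
  assumes "x \<in> PiE {..<n} A"
  shows "first_part n (join n m x y) = x"
proof
  fix i show "first_part n (join n m x y) i = x i"
    using PiE_arb[OF assms, of i] by (auto simp: first_part_def join_def)
qed

lemma second_part_join:
  assumes "y \<in> PiE {..<m} B"
  shows "second_part n m (join n m x y) = y"
proof
  fix j show "second_part n m (join n m x y) j = y j"
    using PiE_arb[OF assms, of j] by (auto simp: second_part_def join_def)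
qed

lemma join_parts:
  assumes "z \<in> PiE {..<n + m} C"
  shows "join n m (first_part n z) (second_part n m z) = z"
proof
  fix i show "join n m (first_part n z) (second_part n m z) i = z i"
    using PiE_arb[OF assms, of i] by (auto simp: first_part_def second_part_def join_def)
qed

lemma join_in_concat:
  assumes "x \<in> PiE {..<n} A" "y \<in> PiE {..<m} B"
  shows "join n m x y \<in> PiE {..<n + m} (concat_family n A B)"
  using assms by (auto simp: join_def concat_family_def PiE_def Pi_def)

lemma parts_in:
  assumes "z \<in> PiE {..<n + m} (concat_family n A B)"
  shows "first_part n z \<in> PiE {..<n} A" "second_part n m z \<in> PiE {..<m} B"
proof -
  have z: "z i \<in> concat_family n A B i" if "i < n + m" for i
    using assms that by blast
  show "first_part n z \<in> PiE {..<n} A"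
  proof (rule PiE_I)
    show "first_part n z i \<in> A i" if "i \<in> {..<n}" for i
      using z[of i] that by (simp add: first_part_def concat_family_def)
  qed (simp add: first_part_def)
  show "second_part n m z \<in> PiE {..<m} B"
  proof (rule PiE_I)
    show "second_part n m z j \<in> B j" if "j \<in> {..<m}" for j
      using z[of "n + j"] that by (simp add: second_part_def concat_family_def)
  qed (simp add: second_part_def)
qed

lemma parts_image_subset:
  assumes "P \<subseteq> PiE {..<n + m} (concat_family n A B)"
  shows "first_part n ` P \<subseteq> PiE {..<n} A" "second_part n m ` P \<subseteq> PiE {..<m} B"
  using assms parts_in[of _ n m A B] by (meson image_subsetI subsetD)+

lemma inj_on_join: "inj_on (\<lambda>(x, y). join n m x y) (PiE {..<n} A \<times> PiE {..<m} B)"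
  by (rule inj_on_inverseI[where g = "\<lambda>z. (first_part n z, second_part n m z)"])
    (auto simp: first_part_join second_part_join)

text \<open>Lets an arbitrary box in the product space be split into a box in each of the two
  spaces.\<close>

lemma concat_family_split: "concat_family n C (\<lambda>j. C (n + j)) = C"
  by (auto simp: concat_family_def fun_eq_iff)

text \<open>Full factors are counted separately below \<open>n\<close> and from \<open>n\<close> on.
  This additivity is what relates orders on the product to orders on the two spaces.\<close>

lemma card_concat_family_eq:
  "card {i. i < n + m \<and> concat_family n A B i = concat_family n X Y i} =
    card {i. i < n \<and> A i = X i} + card {j. j < m \<and> B j = Y j}"
proof -
  have "{i. i < n + m \<and> concat_family n A B i = concat_family n X Y i} =
      {i. i < n \<and> A i = X i} \<union> (\<lambda>j. n + j) ` {j. j < m \<and> B j = Y j}" (is "?U = ?V")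
  proof (intro set_eqI iffI)
    fix i assume i: "i \<in> ?U"
    show "i \<in> ?V"
    proof (cases "i < n")
      case False
      then have "i = n + (i - n)" "i - n \<in> {j. j < m \<and> B j = Y j}"
        using i by (auto simp: concat_family_def)
      then show ?thesis
        by blast
    qed (use i in \<open>auto simp: concat_family_def\<close>)
  qed (auto simp: concat_family_def)
  moreover have "card (?V) = card {i. i < n \<and> A i = X i} + card ((\<lambda>j. n + j) ` {j. j < m \<and> B j = Y j})"
    by (intro card_Un_disjoint) auto
  ultimately show ?thesis
    by (simp add: card_image)
qed

section \<open>Masses and double integrals over a grid of joined points\<close>

lemma sum_join:
  assumes "finite S" "finite T" "S \<subseteq> PiE {..<n} X" "T \<subseteq> PiE {..<m} Y"
  shows "(\<Sum>z\<in>(\<lambda>(x, y). join n m x y) ` (S \<times> T). h z) = (\<Sum>x\<in>S. \<Sum>y\<in>T. h (join n m x y))"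
proof -
  have "inj_on (\<lambda>(x, y). join n m x y) (S \<times> T)"
    using assms(3,4) by (intro inj_on_subset[OF inj_on_join[of n m X Y]]) auto
  then show ?thesis
    by (simp add: sum.reindex sum.cartesian_product case_prod_unfold)
qed

text \<open>A box meets the grid of \<open>S\<close> and \<open>T\<close> in a subgrid. The grid may
  exceed the support, so that points can be inserted into \<open>S\<close> or
  \<open>T\<close>.\<close>

lemma mass_concat:
  assumes "finite S" "finite T" "S \<subseteq> PiE {..<n} X" "T \<subseteq> PiE {..<m} Y"
    and supp: "support \<mu> \<subseteq> (\<lambda>(x, y). join n m x y) ` (S \<times> T)"
  shows "mass \<mu> (PiE {..<n + m} (concat_family n A B)) =
    (\<Sum>x\<in>S \<inter> PiE {..<n} A. \<Sum>y\<in>T \<inter> PiE {..<m} B. \<mu> (join n m x y))"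
proof -
  have iff: "join n m x y \<in> PiE {..<n + m} (concat_family n A B) \<longleftrightarrow>
      x \<in> PiE {..<n} A \<and> y \<in> PiE {..<m} B" if "x \<in> S" "y \<in> T" for x y
  proof -
    have "first_part n (join n m x y) = x" "second_part n m (join n m x y) = y"
      using first_part_join[OF subsetD[OF assms(3) that(1)]]
        second_part_join[OF subsetD[OF assms(4) that(2)]] by simp_all
    then show ?thesis
      using join_in_concat[of x n A y m B] parts_in[of "join n m x y" n m A B] by metis
  qed
  have "(\<lambda>(x, y). join n m x y) ` (S \<times> T) \<inter> PiE {..<n + m} (concat_family n A B) =
      (\<lambda>(x, y). join n m x y) ` ((S \<inter> PiE {..<n} A) \<times> (T \<inter> PiE {..<m} B))"
  proof (intro equalityI subsetI)
    fix z
    assume z: "z \<in> (\<lambda>(x, y). join n m x y) ` (S \<times> T) \<inter> PiE {..<n + m} (concat_family n A B)"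
    from IntD1[OF z] obtain x y where "x \<in> S" "y \<in> T" "z = join n m x y"
      by auto
    with IntD2[OF z] show "z \<in> (\<lambda>(x, y). join n m x y) ` ((S \<inter> PiE {..<n} A) \<times> (T \<inter> PiE {..<m} B))"
      using iff[of x y] by (intro image_eqI[of _ _ "(x, y)"]) simp_all
  next
    fix z
    assume "z \<in> (\<lambda>(x, y). join n m x y) ` ((S \<inter> PiE {..<n} A) \<times> (T \<inter> PiE {..<m} B))"
    then obtain x y where "x \<in> S \<inter> PiE {..<n} A" "y \<in> T \<inter> PiE {..<m} B" "z = join n m x y"
      by (elim imageE SigmaE) simp
    then show "z \<in> (\<lambda>(x, y). join n m x y) ` (S \<times> T) \<inter> PiE {..<n + m} (concat_family n A B)"
      using iff[of x y] by (intro IntI image_eqI[of _ _ "(x, y)"]) simp_all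
  qed
  moreover have "mass \<mu> (PiE {..<n + m} (concat_family n A B)) =
      (\<Sum>z\<in>(\<lambda>(x, y). join n m x y) ` (S \<times> T) \<inter> PiE {..<n + m} (concat_family n A B). \<mu> z)"
    using assms(1,2) supp by (intro mass_eq_sum) auto
  moreover have "(\<Sum>z\<in>(\<lambda>(x, y). join n m x y) ` ((S \<inter> PiE {..<n} A) \<times> (T \<inter> PiE {..<m} B)). \<mu> z) =
      (\<Sum>x\<in>S \<inter> PiE {..<n} A. \<Sum>y\<in>T \<inter> PiE {..<m} B. \<mu> (join n m x y))"
    using assms(1-4) by (intro sum_join[of _ _ _ X _ Y]) (simp_all add: le_infI1)
  ultimately show ?thesis
    by simp
qed

text \<open>With \<open>\<mu>\<close> read as a matrix, the integral pairs \<open>L\<close> with the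
  Gram matrix of its columns under \<open>I\<close>, the shape treated by
  \<open>tensor_form_pos\<close>.\<close>

lemma double_integral_prod_kernel:
  assumes "finite S" "finite T" "S \<subseteq> PiE {..<n} X" "T \<subseteq> PiE {..<m} Y"
    and supp: "support \<mu> \<subseteq> (\<lambda>(x, y). join n m x y) ` (S \<times> T)"
  shows "double_integral (prod_kernel n m I L) \<mu> =
    (\<Sum>y\<in>T. \<Sum>y'\<in>T. L y y' * form S I (\<lambda>x. \<mu> (join n m x y)) (\<lambda>x. \<mu> (join n m x y')))"
proof -
  have K: "prod_kernel n m I L (join n m x y) (join n m x' y') = I x x' * L y y'"
    if "x \<in> S" "x' \<in> S" "y \<in> T" "y' \<in> T" for x x' y y'
  proof -
    have "x \<in> PiE {..<n} X" "x' \<in> PiE {..<n} X" "y \<in> PiE {..<m} Y" "y' \<in> PiE {..<m} Y"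
      using that assms by auto
    then show ?thesis
      by (simp add: prod_kernel_def first_part_join second_part_join)
  qed
  define G where "G = (\<lambda>x y x' y'. I x x' * L y y' * \<mu> (join n m x y) * \<mu> (join n m x' y'))"
  have "double_integral (prod_kernel n m I L) \<mu> = (\<Sum>x\<in>S. \<Sum>y\<in>T. \<Sum>x'\<in>S. \<Sum>y'\<in>T.
      prod_kernel n m I L (join n m x y) (join n m x' y') * \<mu> (join n m x y) * \<mu> (join n m x' y'))"
    using assms by (subst double_integral_eq_form[OF _ supp]) (simp_all add: form_def sum_join)
  also have "\<dots> = (\<Sum>x\<in>S. \<Sum>y\<in>T. \<Sum>x'\<in>S. \<Sum>y'\<in>T. G x y x' y')"
    by (intro sum.cong refl) (simp add: K G_def)
  also have "\<dots> = (\<Sum>y\<in>T. \<Sum>x\<in>S. \<Sum>x'\<in>S. \<Sum>y'\<in>T. G x y x' y')"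
    by (rule sum.swap)
  also have "\<dots> = (\<Sum>y\<in>T. \<Sum>x\<in>S. \<Sum>y'\<in>T. \<Sum>x'\<in>S. G x y x' y')"
    by (intro sum.cong refl sum.swap)
  also have "\<dots> = (\<Sum>y\<in>T. \<Sum>y'\<in>T. \<Sum>x\<in>S. \<Sum>x'\<in>S. G x y x' y')"
    by (intro sum.cong refl sum.swap)
  finally show ?thesis
    by (simp add: G_def form_def sum_distrib_left mult_ac)
qed

text \<open>Supplies the canonical grid: the two projections of the support.\<close>

lemma support_subset_join:
  assumes "support \<mu> \<subseteq> PiE {..<n + m} (concat_family n X Y)"
  shows "support \<mu> \<subseteq> (\<lambda>(x, y). join n m x y) `
    (first_part n ` support \<mu> \<times> second_part n m ` support \<mu>)"
proof
  fix z assume z: "z \<in> support \<mu>"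
  then have "z = join n m (first_part n z) (second_part n m z)"
    using assms join_parts by (metis subsetD)
  then show "z \<in> (\<lambda>(x, y). join n m x y) ` (first_part n ` support \<mu> \<times> second_part n m ` support \<mu>)"
    using z by (metis (mono_tags, lifting) SigmaI case_prod_conv image_eqI)
qed

section \<open>Symmetry under interchange of coordinates\<close>

lemma multi_symmetric_commute:
  assumes "multi_symmetric N Z T" "u \<in> PiE {..<N} Z" "v \<in> PiE {..<N} Z"
  shows "T u v = T v u"
proof -
  \<comment> \<open>Interchanging all coordinates swaps the two points; extensionality settles the
    remaining arguments.\<close>
  have "override_on u v {..<N} = v" "override_on v u {..<N} = u"
    using assms(2,3) by (auto simp: override_on_def fun_eq_iff PiE_def extensional_def)
  then show ?thesis
    using assms unfolding multi_symmetric_def by (metis subset_refl)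
qed

lemma multi_symmetric_scale:
  "multi_symmetric N Z T \<Longrightarrow> multi_symmetric N Z (\<lambda>u v. c * T u v)"
  by (simp add: multi_symmetric_def)

lemma multi_symmetric_prod_kernel:
  assumes "multi_symmetric n X I" "multi_symmetric m Y L"
  shows "multi_symmetric (n + m) (concat_family n X Y) (prod_kernel n m I L)"
  unfolding multi_symmetric_def
proof (intro ballI allI impI)
  fix u v J
  assume u: "u \<in> PiE {..<n + m} (concat_family n X Y)"
    and v: "v \<in> PiE {..<n + m} (concat_family n X Y)" and "J \<subseteq> {..<n + m}"
  \<comment> \<open>An interchange set splits into its trace on the first \<open>n\<close> indices
    and the shifted trace on the last \<open>m\<close>.\<close>
  define J1 where "J1 = J \<inter> {..<n}"
  define J2 where "J2 = {j. j < m \<and> n + j \<in> J}"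
  have "first_part n (override_on u v J) = override_on (first_part n u) (first_part n v) J1"
    and "second_part n m (override_on u v J) = override_on (second_part n m u) (second_part n m v) J2"
    for u v :: "nat \<Rightarrow> 'a"
    by (auto simp: first_part_def second_part_def override_on_def fun_eq_iff J1_def J2_def)
  moreover have "J1 \<subseteq> {..<n}" "J2 \<subseteq> {..<m}"
    by (auto simp: J1_def J2_def)
  ultimately show "prod_kernel n m I L (override_on u v J) (override_on v u J) = prod_kernel n m I L u v"
    using assms parts_in[OF u] parts_in[OF v] by (simp add: prod_kernel_def multi_symmetric_def)
qed

section \<open>Definiteness of product kernels\<close>

text \<open>Strict positivity stripped of symmetry and of the sign \<open>(-1)^k\<close>, so that
  order and sign can vary independently.\<close>

definition positive_on :: "('z \<Rightarrow> real) set \<Rightarrow> ('z \<Rightarrow> 'z \<Rightarrow> real) \<Rightarrow> bool" where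
  "positive_on M T \<longleftrightarrow> (\<forall>\<mu>\<in>M. \<mu> \<noteq> (\<lambda>_. 0) \<longrightarrow> double_integral T \<mu> > 0)"

text \<open>The zero measure has integral zero, so nonnegativity with equality only at zero is
  strict positivity elsewhere.\<close>

lemma SPDI_iff_positive_on:
  assumes "multi_symmetric N Z T"
  shows "SPDI k N Z T \<longleftrightarrow> positive_on (measures_order k N Z) (\<lambda>u v. (-1) ^ k * T u v)"
proof -
  have "double_integral Q \<mu> \<ge> 0 \<and> (double_integral Q \<mu> = 0 \<longrightarrow> \<mu> = (\<lambda>_. 0)) \<longleftrightarrow>
      (\<mu> \<noteq> (\<lambda>_. 0) \<longrightarrow> double_integral Q \<mu> > 0)" for Q and \<mu> :: "(nat \<Rightarrow> 'a) \<Rightarrow> real"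
    by (cases "\<mu> = (\<lambda>_. 0)") auto
  then show ?thesis
    unfolding SPDI_def positive_on_def using assms by simp
qed

lemma SPDI_scale_iff:
  assumes "multi_symmetric N Z T"
  shows "SPDI k N Z (\<lambda>u v. c * T u v) \<longleftrightarrow>
    positive_on (measures_order k N Z) (\<lambda>u v. (-1) ^ k * c * T u v)"
  using SPDI_iff_positive_on[OF multi_symmetric_scale[OF assms]] by (simp add: mult.assoc)

lemma SPD_iff_positive_on: "SPD N Z T \<longleftrightarrow> positive_on (measures_order 0 N Z) T"
  by (simp add: SPD_def positive_on_def measures_order_0)

text \<open>
  Fixing one part of a point uses up all coordinates of that factor, so the slices of a measure
  of order \<open>k\<close> have the orders \<open>k - m\<close> and \<open>k - n\<close>.
\<close>

lemma slices_in_measures_order: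
  assumes \<mu>: "\<mu> \<in> measures_order k (n + m) (concat_family n X Y)"
  shows "x \<in> PiE {..<n} X \<Longrightarrow> q = 0 \<or> n + q \<le> k \<Longrightarrow>
      (\<lambda>y. if y \<in> PiE {..<m} Y then \<mu> (join n m x y) else 0) \<in> measures_order q m Y"
    and "y \<in> PiE {..<m} Y \<Longrightarrow> p = 0 \<or> p + m \<le> k \<Longrightarrow>
      (\<lambda>x. if x \<in> PiE {..<n} X then \<mu> (join n m x y) else 0) \<in> measures_order p n X"
proof -
  define S0 where "S0 = first_part n ` support \<mu>"
  define T0 where "T0 = second_part n m ` support \<mu>"
  have fin: "finite S0" "finite T0"
    using measures_orderD(1)[OF \<mu>] by (auto simp: S0_def T0_def)
  have S0: "S0 \<subseteq> PiE {..<n} X" and T0: "T0 \<subseteq> PiE {..<m} Y"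
    unfolding S0_def T0_def using parts_image_subset[OF measures_orderD(2)[OF \<mu>]] by simp_all
  have supp: "support \<mu> \<subseteq> (\<lambda>(x, y). join n m x y) ` (S0 \<times> T0)"
    using support_subset_join[OF measures_orderD(2)[OF \<mu>]] by (simp add: S0_def T0_def)
  have null: "mass \<mu> (PiE {..<n + m} (concat_family n A B)) = 0"
    if "\<And>i. i < n \<Longrightarrow> A i \<subseteq> X i" "\<And>j. j < m \<Longrightarrow> B j \<subseteq> Y j"
      "card {i. i < n \<and> A i = X i} + card {j. j < m \<and> B j = Y j} \<ge> n + m - k + 1" for A B
  proof (rule measures_orderD(3)[OF \<mu>])
    show "concat_family n A B i \<subseteq> concat_family n X Y i" if "i < n + m" for i
      using that \<open>\<And>i. i < n \<Longrightarrow> A i \<subseteq> X i\<close> \<open>\<And>j. j < m \<Longrightarrow> B j \<subseteq> Y j\<close>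
      by (auto simp: concat_family_def)
  qed (use that in \<open>simp add: card_concat_family_eq\<close>)
  have mem: "x \<in> S0 \<and> y \<in> T0"
    if "x \<in> PiE {..<n} X" "y \<in> PiE {..<m} Y" "\<mu> (join n m x y) \<noteq> 0" for x y
  proof -
    have "join n m x y \<in> support \<mu>"
      using that by (simp add: support_def)
    then show ?thesis
      unfolding S0_def T0_def using that first_part_join second_part_join by (metis imageI)
  qed
  {
    assume x: "x \<in> PiE {..<n} X" and q: "q = 0 \<or> n + q \<le> k"
    define \<nu> where "\<nu> = (\<lambda>y. if y \<in> PiE {..<m} Y then \<mu> (join n m x y) else 0)"
    have \<nu>: "support \<nu> \<subseteq> T0"
      using mem[OF x] by (auto simp: support_def \<nu>_def split: if_splits)
    have "\<nu> \<in> measures_order q m Y"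
    proof (rule measures_orderI)
      show "finite (support \<nu>)" "support \<nu> \<subseteq> PiE {..<m} Y"
        using \<nu> fin T0 by (auto intro: finite_subset)
      fix B assume B: "\<And>j. j < m \<Longrightarrow> B j \<subseteq> Y j" "card {j. j < m \<and> B j = Y j} \<ge> m - q + 1"
      \<comment> \<open>For \<open>q = 0\<close> the threshold \<open>m + 1\<close> is out of reach,
        so the condition tests something only when \<open>n + q \<le> k\<close>.\<close>
      have "q > 0"
        using B(2) card_bounded_nat_le[of m "\<lambda>j. B j = Y j"] by (cases q) auto
      \<comment> \<open>The box of singletons isolates the slice at \<open>x\<close>. Since
        \<open>x\<close> may lie outside the projection \<open>S0\<close>, it is inserted
        there.\<close>
      have px: "PiE {..<n} (\<lambda>i. {x i}) = {x}"
        using x by (intro PiE_singleton) (auto simp: PiE_def)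
      have "insert x S0 \<inter> PiE {..<n} (\<lambda>i. {x i}) = {x}"
        using px by auto
      moreover have "mass \<mu> (PiE {..<n + m} (concat_family n (\<lambda>i. {x i}) B)) =
          (\<Sum>u\<in>insert x S0 \<inter> PiE {..<n} (\<lambda>i. {x i}). \<Sum>y\<in>T0 \<inter> PiE {..<m} B. \<mu> (join n m u y))"
        using fin S0 T0 x supp by (intro mass_concat[of _ _ _ X _ Y]) auto
      moreover have "mass \<nu> (PiE {..<m} B) = (\<Sum>y\<in>T0 \<inter> PiE {..<m} B. \<mu> (join n m x y))"
        unfolding mass_eq_sum[OF fin(2) \<nu>] using T0 by (intro sum.cong) (auto simp: \<nu>_def)
      ultimately have "mass \<nu> (PiE {..<m} B) =
          mass \<mu> (PiE {..<n + m} (concat_family n (\<lambda>i. {x i}) B))"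
        by simp
      also have "\<dots> = 0"
        \<comment> \<open>The full factors of \<open>B\<close> alone reach the threshold:
          \<open>m - q + 1\<close> is at least \<open>n + m - k + 1\<close>.\<close>
        using x B q \<open>q > 0\<close> by (intro null) auto
      finally show "mass \<nu> (PiE {..<m} B) = 0" .
    qed
    then show "(\<lambda>y. if y \<in> PiE {..<m} Y then \<mu> (join n m x y) else 0) \<in> measures_order q m Y"
      unfolding \<nu>_def .
  next
    \<comment> \<open>The same argument with the roles exchanged; the singleton box now fixes
      \<open>y\<close>.\<close>
    assume y: "y \<in> PiE {..<m} Y" and p: "p = 0 \<or> p + m \<le> k"
    define \<nu> where "\<nu> = (\<lambda>x. if x \<in> PiE {..<n} X then \<mu> (join n m x y) else 0)"
    have \<nu>: "support \<nu> \<subseteq> S0"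
      using mem[OF _ y] by (auto simp: support_def \<nu>_def split: if_splits)
    have "\<nu> \<in> measures_order p n X"
    proof (rule measures_orderI)
      show "finite (support \<nu>)" "support \<nu> \<subseteq> PiE {..<n} X"
        using \<nu> fin S0 by (auto intro: finite_subset)
      fix A assume A: "\<And>i. i < n \<Longrightarrow> A i \<subseteq> X i" "card {i. i < n \<and> A i = X i} \<ge> n - p + 1"
      have "p > 0"
        using A(2) card_bounded_nat_le[of n "\<lambda>i. A i = X i"] by (cases p) auto
      have py: "PiE {..<m} (\<lambda>j. {y j}) = {y}"
        using y by (intro PiE_singleton) (auto simp: PiE_def)
      have "insert y T0 \<inter> PiE {..<m} (\<lambda>j. {y j}) = {y}"
        using py by auto
      moreover have "mass \<mu> (PiE {..<n + m} (concat_family n A (\<lambda>j. {y j}))) =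
          (\<Sum>x\<in>S0 \<inter> PiE {..<n} A. \<Sum>v\<in>insert y T0 \<inter> PiE {..<m} (\<lambda>j. {y j}). \<mu> (join n m x v))"
        using fin S0 T0 y supp by (intro mass_concat[of _ _ _ X _ Y]) auto
      moreover have "mass \<nu> (PiE {..<n} A) = (\<Sum>x\<in>S0 \<inter> PiE {..<n} A. \<mu> (join n m x y))"
        unfolding mass_eq_sum[OF fin(1) \<nu>] using S0 by (intro sum.cong) (auto simp: \<nu>_def)
      ultimately have "mass \<nu> (PiE {..<n} A) =
          mass \<mu> (PiE {..<n + m} (concat_family n A (\<lambda>j. {y j})))"
        by simp
      also have "\<dots> = 0"
        using y A p \<open>p > 0\<close> by (intro null) auto
      finally show "mass \<nu> (PiE {..<n} A) = 0" .
    qed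
    then show "(\<lambda>x. if x \<in> PiE {..<n} X then \<mu> (join n m x y) else 0) \<in> measures_order p n X"
      unfolding \<nu>_def .
  }
qed

text \<open>Columns and rows of \<open>\<mu>\<close> are slices, hence of orders \<open>p\<close>
  and \<open>q\<close>, and \<open>tensor_form_pos\<close> applies. Order 0 is always available
  because slices are finitely supported.\<close>

lemma positive_on_prod_kernel:
  assumes sym: "multi_symmetric n X I"
    and I: "positive_on (measures_order p n X) I" and L: "positive_on (measures_order q m Y) L"
    and p: "p = 0 \<or> p + m \<le> k" and q: "q = 0 \<or> n + q \<le> k"
  shows "positive_on (measures_order k (n + m) (concat_family n X Y)) (prod_kernel n m I L)"
  unfolding positive_on_def
proof (intro ballI impI)
  fix \<mu> :: "(nat \<Rightarrow> 'a) \<Rightarrow> real"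
  assume \<mu>: "\<mu> \<in> measures_order k (n + m) (concat_family n X Y)" and "\<mu> \<noteq> (\<lambda>_. 0)"
  then obtain z where z: "\<mu> z \<noteq> 0"
    by auto
  define S where "S = first_part n ` support \<mu>"
  define T where "T = second_part n m ` support \<mu>"
  have fin: "finite S" "finite T"
    using measures_orderD(1)[OF \<mu>] by (auto simp: S_def T_def)
  have S: "S \<subseteq> PiE {..<n} X" and T: "T \<subseteq> PiE {..<m} Y"
    unfolding S_def T_def using parts_image_subset[OF measures_orderD(2)[OF \<mu>]] by simp_all
  have supp: "support \<mu> \<subseteq> (\<lambda>(x, y). join n m x y) ` (S \<times> T)"
    using support_subset_join[OF measures_orderD(2)[OF \<mu>]] by (simp add: S_def T_def)
  \<comment> \<open>\<open>join\<close> ignores values of \<open>x\<close> beyond its range, so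
    without the cut-off entries would repeat at points outside the product.\<close>
  define F where "F = (\<lambda>x y. if x \<in> PiE {..<n} X \<and> y \<in> PiE {..<m} Y then \<mu> (join n m x y) else 0)"
  \<comment> \<open>Confining supports to \<open>S\<close> and \<open>T\<close> identifies the forms
    on these sets with the double integrals.\<close>
  define V where "V = {f \<in> measures_order p n X. support f \<subseteq> S}"
  define W where "W = {g \<in> measures_order q m Y. support g \<subseteq> T}"
  have F_supp: "x \<in> S \<and> y \<in> T" if "F x y \<noteq> 0" for x y
  proof -
    have "join n m x y \<in> support \<mu>" "x \<in> PiE {..<n} X" "y \<in> PiE {..<m} Y"
      using that by (auto simp: F_def support_def split: if_splits)
    then show ?thesis
      unfolding S_def T_def using first_part_join second_part_join by (metis imageI)
  qed
  have "(\<Sum>y\<in>T. \<Sum>y'\<in>T. L y y' * form S I (\<lambda>x. F x y) (\<lambda>x. F x y')) > 0"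
  proof (rule tensor_form_pos[where V = V and W = W])
    show "finite T"
      by fact
    show "I x x' = I x' x" if "x \<in> S" "x' \<in> S" for x x'
      using that S by (intro multi_symmetric_commute[OF sym]) auto
    show "(\<lambda>x. f x - c * g x) \<in> V" if "f \<in> V" "g \<in> V" for f g c
      using that measures_order_diff[of f p n X g c] support_diff[of f c g] unfolding V_def by blast
    show "(\<lambda>x. f x - c * g x) \<in> W" if "f \<in> W" "g \<in> W" for f g c
      using that measures_order_diff[of f q m Y g c] support_diff[of f c g] unfolding W_def by blast
    show "(\<lambda>y. \<Sum>x\<in>S. r x * g x y) \<in> W" if g: "\<And>x. x \<in> S \<Longrightarrow> g x \<in> W" for r g
    proof -
      have "g x y = 0" if "x \<in> S" "y \<notin> T" for x y
        using g[OF that(1)] that(2) by (auto simp: W_def support_def)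
      then have "(\<Sum>x\<in>S. r x * g x y) = 0" if "y \<notin> T" for y
        using that by simp
      then show ?thesis
        using g measures_order_sum[OF fin(1), of g q m Y r] by (auto simp: W_def support_def)
    qed
    show "form S I f f > 0" if "f \<in> V" "f \<noteq> (\<lambda>_. 0)" for f
      using that I fin(1) by (auto simp: V_def positive_on_def double_integral_eq_form)
    show "form T L g g > 0" if "g \<in> W" "g \<noteq> (\<lambda>_. 0)" for g
      using that L fin(2) by (auto simp: W_def positive_on_def double_integral_eq_form)
    show "(\<lambda>x. F x y) \<in> V" for y
    proof -
      have "(\<lambda>x. F x y) \<in> measures_order p n X"
      proof (cases "y \<in> PiE {..<m} Y")
        case True
        then show ?thesis
          using slices_in_measures_order(2)[OF \<mu> True p] by (simp add: F_def)
      next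
        case False
        then have "(\<lambda>x. F x y) = (\<lambda>_. 0)"
          by (auto simp: F_def)
        then show ?thesis
          by (simp add: zero_in_measures_order)
      qed
      then show ?thesis
        using F_supp by (auto simp: V_def support_def)
    qed
    show "F x \<in> W" for x
    proof -
      have "F x \<in> measures_order q m Y"
      proof (cases "x \<in> PiE {..<n} X")
        case True
        then have "F x = (\<lambda>y. if y \<in> PiE {..<m} Y then \<mu> (join n m x y) else 0)"
          by (simp add: F_def)
        then show ?thesis
          using slices_in_measures_order(1)[OF \<mu> True q] by simp
      next
        case False
        then have "F x = (\<lambda>_. 0)"
          by (auto simp: F_def)
        then show ?thesis
          by (simp add: zero_in_measures_order)
      qed
      then show ?thesis
        using F_supp by (auto simp: W_def support_def)
    qed
    show "F x y = 0" if "y \<notin> T" for x y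
      using that F_supp by blast
    have "z \<in> PiE {..<n + m} (concat_family n X Y)"
      using z measures_orderD(2)[OF \<mu>] by (auto simp: support_def)
    then show "F (first_part n z) (second_part n m z) \<noteq> 0"
      using z by (simp add: F_def parts_in join_parts)
  qed
  also have "(\<Sum>y\<in>T. \<Sum>y'\<in>T. L y y' * form S I (\<lambda>x. F x y) (\<lambda>x. F x y')) =
      double_integral (prod_kernel n m I L) \<mu>"
  proof -
    have "F x y = \<mu> (join n m x y)" if "x \<in> S" "y \<in> T" for x y
      using that S T by (auto simp: F_def)
    then show ?thesis
      unfolding double_integral_prod_kernel[OF fin S T supp] form_def by simp
  qed
  finally show "double_integral (prod_kernel n m I L) \<mu> > 0" .
qed

section \<open>From the product kernel back to its factors\<close>

lemma exists_product_measure: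
  assumes \<mu>: "\<mu> \<in> measures_order p n X" and \<nu>: "\<nu> \<in> measures_order q m Y"
    and "p \<le> n" "q \<le> m" "k \<le> p + q"
    and ne: "\<mu> \<noteq> (\<lambda>_. 0)" "\<nu> \<noteq> (\<lambda>_. 0)"
  shows "\<exists>\<rho>\<in>measures_order k (n + m) (concat_family n X Y). \<rho> \<noteq> (\<lambda>_. 0) \<and>
    double_integral (prod_kernel n m I L) \<rho> = double_integral I \<mu> * double_integral L \<nu>"
proof -
  define S where "S = support \<mu>"
  define T where "T = support \<nu>"
  define P where "P = (\<lambda>(x, y). join n m x y) ` (S \<times> T)"
  \<comment> \<open>The product measure of \<open>\<mu>\<close> and \<open>\<nu>\<close>, set to
    zero off the grid, where distinct points may share the same parts.\<close>
  define \<rho> where "\<rho> = (\<lambda>z. if z \<in> P then \<mu> (first_part n z) * \<nu> (second_part n m z) else 0)"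
  have fin: "finite S" "finite T" and S: "S \<subseteq> PiE {..<n} X" and T: "T \<subseteq> PiE {..<m} Y"
    using measures_orderD(1,2)[OF \<mu>] measures_orderD(1,2)[OF \<nu>] by (auto simp: S_def T_def)
  have supp: "support \<rho> \<subseteq> (\<lambda>(x, y). join n m x y) ` (S \<times> T)"
    by (auto simp: support_def \<rho>_def P_def)
  have \<rho>_join: "\<rho> (join n m x y) = \<mu> x * \<nu> y" if "x \<in> S" "y \<in> T" for x y
  proof -
    have "join n m x y \<in> P" "x \<in> PiE {..<n} X" "y \<in> PiE {..<m} Y"
      using that S T by (auto simp: P_def)
    then show ?thesis
      by (simp add: \<rho>_def first_part_join second_part_join)
  qed
  have "\<rho> \<in> measures_order k (n + m) (concat_family n X Y)"
  proof (rule measures_orderI)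
    show "finite (support \<rho>)"
      using supp fin by (auto intro: finite_subset)
    show "support \<rho> \<subseteq> PiE {..<n + m} (concat_family n X Y)"
    proof
      fix z assume "z \<in> support \<rho>"
      from subsetD[OF supp this] obtain x y where xy: "x \<in> S" "y \<in> T" "z = join n m x y"
        by auto
      then show "z \<in> PiE {..<n + m} (concat_family n X Y)"
        using join_in_concat[OF subsetD[OF S xy(1)] subsetD[OF T xy(2)]] by simp
    qed
  next
    fix C assume C: "\<And>i. i < n + m \<Longrightarrow> C i \<subseteq> concat_family n X Y i"
      "card {i. i < n + m \<and> C i = concat_family n X Y i} \<ge> n + m - k + 1"
    define B where "B = (\<lambda>j. C (n + j))"
    have C_eq: "C = concat_family n C B"
      by (simp add: B_def concat_family_split)
    have sub: "C i \<subseteq> X i" if "i < n" for i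
      using C(1)[of i] that by (simp add: concat_family_def)
    have sub': "B j \<subseteq> Y j" if "j < m" for j
      using C(1)[of "n + j"] that by (simp add: concat_family_def B_def)
    have "card {i. i < n \<and> C i = X i} + card {j. j < m \<and> B j = Y j} \<ge> n + m - k + 1"
      using C(2) card_concat_family_eq[of n m C B X Y] C_eq by simp
    \<comment> \<open>Pigeonhole: otherwise there would be at most \<open>(n - p) + (m - q)\<close>
      full factors, which is at most \<open>n + m - k\<close>.\<close>
    then have "card {i. i < n \<and> C i = X i} \<ge> n - p + 1 \<or> card {j. j < m \<and> B j = Y j} \<ge> m - q + 1"
      using assms(3-5) by linarith
    then have "mass \<mu> (PiE {..<n} C) * mass \<nu> (PiE {..<m} B) = 0"
      using measures_orderD(3)[OF \<mu>, of C] measures_orderD(3)[OF \<nu>, of B] sub sub' by auto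
    moreover have "mass \<rho> (PiE {..<n + m} C) = mass \<mu> (PiE {..<n} C) * mass \<nu> (PiE {..<m} B)"
      using mass_concat[OF fin S T supp, of C B] \<rho>_join C_eq
      by (simp add: mass_def S_def T_def sum_product)
    ultimately show "mass \<rho> (PiE {..<n + m} C) = 0"
      by simp
  qed
  moreover have "\<rho> \<noteq> (\<lambda>_. 0)"
  proof -
    obtain x y where "x \<in> S" "y \<in> T"
      using ne by (auto simp: S_def T_def support_def fun_eq_iff)
    then have "\<rho> (join n m x y) \<noteq> 0"
      by (simp add: \<rho>_join S_def T_def support_def)
    then show ?thesis
      by auto
  qed
  moreover have "double_integral (prod_kernel n m I L) \<rho> = double_integral I \<mu> * double_integral L \<nu>"
  proof -
    have "form S I (\<lambda>x. \<rho> (join n m x y)) (\<lambda>x. \<rho> (join n m x y')) =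
        double_integral I \<mu> * (\<nu> y * \<nu> y')" if "y \<in> T" "y' \<in> T" for y y'
      using that \<rho>_join
      by (simp add: form_def double_integral_def S_def[symmetric] sum_distrib_left mult_ac)
    then have "double_integral (prod_kernel n m I L) \<rho> =
        (\<Sum>y\<in>T. \<Sum>y'\<in>T. L y y' * (double_integral I \<mu> * (\<nu> y * \<nu> y')))"
      unfolding double_integral_prod_kernel[OF fin S T supp] by simp
    also have "\<dots> = double_integral I \<mu> * double_integral L \<nu>"
      by (simp add: double_integral_def[of L] T_def[symmetric] sum_distrib_left mult_ac)
    finally show ?thesis .
  qed
  ultimately show ?thesis
    by blast
qed

text \<open>The orders \<open>i\<close> and \<open>j\<close> are high enough that
  \<open>\<mu>0\<close> times any measure of order \<open>q\<close>, and any measure of order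
  \<open>p\<close> times \<open>\<nu>0\<close>, has order \<open>k\<close>.\<close>

lemma factors_positive_on:
  fixes c :: real
  assumes K: "positive_on (measures_order k (n + m) (concat_family n X Y))
      (\<lambda>z z'. c * prod_kernel n m I L z z')"
    and "\<mu>0 \<in> measures_order i n X" "\<mu>0 \<noteq> (\<lambda>_. 0)"
    and "\<nu>0 \<in> measures_order j m Y" "\<nu>0 \<noteq> (\<lambda>_. 0)"
    and "p \<le> i" "i \<le> n" "q \<le> j" "j \<le> m" "k \<le> p + j" "k \<le> i + q" and c: "c \<in> {1, -1}"
  shows "\<exists>s\<in>{1, -1}. positive_on (measures_order p n X) (\<lambda>x x'. s * c * I x x') \<and>
    positive_on (measures_order q m Y) (\<lambda>y y'. s * L y y')"
proof -
  have prod: "c * (double_integral I \<mu> * double_integral L \<nu>) > 0"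
    if "\<mu> \<in> measures_order p' n X" "\<nu> \<in> measures_order q' m Y" "p' \<le> n" "q' \<le> m" "k \<le> p' + q'"
      "\<mu> \<noteq> (\<lambda>_. 0)" "\<nu> \<noteq> (\<lambda>_. 0)" for \<mu> \<nu> p' q'
    using exists_product_measure[OF that, of I L] K
    by (auto simp: positive_on_def double_integral_scale)
  define s where "s = sgn (double_integral L \<nu>0)"
  have X: "c * (double_integral I \<mu> * double_integral L \<nu>0) > 0"
    if "\<mu> \<in> measures_order p n X" "\<mu> \<noteq> (\<lambda>_. 0)" for \<mu>
    using that assms by (intro prod[where p' = p and q' = j]) auto
  have Y: "c * (double_integral I \<mu>0 * double_integral L \<nu>) > 0"
    if "\<nu> \<in> measures_order q m Y" "\<nu> \<noteq> (\<lambda>_. 0)" for \<nu>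
    using that assms by (intro prod[where p' = i and q' = q]) auto
  \<comment> \<open>As \<open>p \<le> i\<close>, \<open>\<mu>0\<close> also has order
    \<open>p\<close>. This pair makes \<open>s\<close> nonzero and links the sign of
    \<open>I\<close> at \<open>\<mu>0\<close>, which governs \<open>L\<close> on order
    \<open>q\<close>, to \<open>s\<close>.\<close>
  have \<mu>0: "c * (double_integral I \<mu>0 * double_integral L \<nu>0) > 0"
    using assms measures_order_antimono[of p i n X] by (intro X) auto
  then have "s \<in> {1, -1}"
    by (auto simp: s_def sgn_if)
  moreover have "s * c * double_integral I \<mu> > 0"
    if "\<mu> \<in> measures_order p n X" "\<mu> \<noteq> (\<lambda>_. 0)" for \<mu>
    using X[OF that] c by (auto simp: s_def sgn_if zero_less_mult_iff mult_less_0_iff split: if_splits)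
  moreover have "s * double_integral L \<nu> > 0"
    if "\<nu> \<in> measures_order q m Y" "\<nu> \<noteq> (\<lambda>_. 0)" for \<nu>
    using Y[OF that] \<mu>0 c
    by (auto simp: s_def sgn_if zero_less_mult_iff mult_less_0_iff split: if_splits)
  ultimately show ?thesis
    by (intro bexI[of _ s]) (auto simp: positive_on_def double_integral_scale)
qed

lemma positive_on_prod_kernel_signed:
  fixes c s :: real
  assumes "multi_symmetric n X I" "s \<in> {1, -1}"
    and "positive_on (measures_order p n X) (\<lambda>x x'. s * c * I x x')"
    and "positive_on (measures_order q m Y) (\<lambda>y y'. s * L y y')"
    and "p = 0 \<or> p + m \<le> k" "q = 0 \<or> n + q \<le> k"
  shows "positive_on (measures_order k (n + m) (concat_family n X Y))
    (\<lambda>z z'. c * prod_kernel n m I L z z')"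
proof -
  \<comment> \<open>The signs cancel because \<open>s * s = 1\<close>.\<close>
  have "prod_kernel n m (\<lambda>x x'. s * c * I x x') (\<lambda>y y'. s * L y y') =
      (\<lambda>z z'. c * prod_kernel n m I L z z')"
    using assms(2) by (auto simp: prod_kernel_def mult.assoc)
  then show ?thesis
    using positive_on_prod_kernel[OF multi_symmetric_scale[OF assms(1)] assms(3-6)] by simp
qed

text \<open>The truncated orders \<open>k - m\<close> and \<open>k - n\<close> serve both
  directions: each is 0 or exact, as the slices require, and \<open>k \<le> (k - m) + m\<close>,
  \<open>k \<le> n + (k - n)\<close> always hold, as the test products require.\<close>

lemma factors_positive_on_iff:
  fixes c :: real
  assumes "\<And>i. i < n \<Longrightarrow> X i \<noteq> {}" "\<And>j. j < m \<Longrightarrow> Y j \<noteq> {}"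
    and sym: "multi_symmetric n X I" and "k \<le> n + m" and c: "c \<in> {1, -1}"
    and ns: "k > 0 \<longrightarrow> nonsingleton_factors (n + m) (concat_family n X Y)"
  shows "positive_on (measures_order k (n + m) (concat_family n X Y))
      (\<lambda>z z'. c * prod_kernel n m I L z z') \<longleftrightarrow>
    (\<exists>s\<in>{1, -1}. positive_on (measures_order (k - m) n X) (\<lambda>x x'. s * c * I x x') \<and>
      positive_on (measures_order (k - n) m Y) (\<lambda>y y'. s * L y y'))"
    (is "?K \<longleftrightarrow> ?F")
proof
  assume ?F
  then obtain s :: real where s: "s \<in> {1, -1}"
      "positive_on (measures_order (k - m) n X) (\<lambda>x x'. s * c * I x x')"
      "positive_on (measures_order (k - n) m Y) (\<lambda>y y'. s * L y y')"
    by blast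
  show ?K
    by (rule positive_on_prod_kernel_signed[OF sym s]) auto
next
  assume K: ?K
  show ?F
  proof (cases "k = 0")
    case True
    obtain \<mu> \<nu> where \<mu>\<nu>: "\<mu> \<in> measures_order 0 n X" "\<mu> \<noteq> (\<lambda>_. 0)"
        "\<nu> \<in> measures_order 0 m Y" "\<nu> \<noteq> (\<lambda>_. 0)"
      using exists_discrete_measure assms(1,2) by metis
    show ?thesis
      using True c by (intro factors_positive_on[OF K \<mu>\<nu>]) auto
  next
    case False
    then have "nonsingleton_factors (n + m) (concat_family n X Y)"
      using ns by simp
    then have ns: "\<exists>x\<in>concat_family n X Y i. \<exists>y\<in>concat_family n X Y i. x \<noteq> y" if "i < n + m" for i
      using that by (simp add: nonsingleton_factors_def)
    have "\<exists>x\<in>X i. \<exists>y\<in>X i. x \<noteq> y" if "i < n" for i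
      using ns[of i] that by (simp add: concat_family_def)
    moreover have "\<exists>x\<in>Y j. \<exists>y\<in>Y j. x \<noteq> y" if "j < m" for j
      using ns[of "n + j"] that by (simp add: concat_family_def)
    ultimately have "nonsingleton_factors n X" "nonsingleton_factors m Y"
      by (auto simp: nonsingleton_factors_def)
    then obtain \<mu> \<nu> where \<mu>\<nu>: "\<mu> \<in> measures_order n n X" "\<mu> \<noteq> (\<lambda>_. 0)"
        "\<nu> \<in> measures_order m m Y" "\<nu> \<noteq> (\<lambda>_. 0)"
      using exists_measure_top_order by metis
    \<comment> \<open>The fixed measures have top orders \<open>n\<close> and \<open>m\<close>;
      \<open>k \<le> n + m\<close> bounds the truncated orders by these.\<close>
    show ?thesis
      using \<open>k \<le> n + m\<close> c by (intro factors_positive_on[OF K \<mu>\<nu>]) auto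
  qed
qed

section \<open>Reduction of the three claims to orders and signs\<close>

theorem corollary44:
  fixes X Y :: "nat \<Rightarrow> 'a set"
    and I L :: "(nat \<Rightarrow> 'a) \<Rightarrow> (nat \<Rightarrow> 'a) \<Rightarrow> real"
    and n m a b k :: nat
  assumes "\<And>i. i < n \<Longrightarrow> X i \<noteq> {}" and "\<And>j. j < m \<Longrightarrow> Y j \<noteq> {}"
    and "a \<le> n" and "b \<le> m" and "k \<le> n + m"
    and "multi_symmetric n X I" and "multi_symmetric m Y L"
  shows
    "(let Z = concat_family n X Y; K = prod_kernel n m I L;
          a' = nat (max (int k - int m) 0); b' = nat (max (int k - int n) 0);
          factors = (\<exists>l\<in>{0, 1::nat}.
            SPDI a' n X (\<lambda>x x'. (-1) ^ (a' + k + l) * I x x') \<and>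
            SPDI b' m Y (\<lambda>y y'. (-1) ^ (b' + l) * L y y'))
      in (factors \<longrightarrow> SPDI k (n + m) Z K) \<and>
         ((k > 0 \<longrightarrow> nonsingleton_factors (n + m) Z) \<longrightarrow>
            (SPDI k (n + m) Z K \<longleftrightarrow> factors)))
   \<and> (let Z = concat_family n X Y; K = prod_kernel n m I L;
          k' = nat (max (int (a + m) * sgn (int a)) (int (n + b) * sgn (int b)));
          factors = (\<exists>l\<in>{0, 1::nat}.
            SPDI a n X (\<lambda>x x'. (-1) ^ l * I x x') \<and>
            SPDI b m Y (\<lambda>y y'. (-1) ^ l * L y y'));
          product = SPDI k' (n + m) Z (\<lambda>z z'. (-1) ^ (k' + a + b) * K z z')
      in (factors \<longrightarrow> product) \<and>
         (int (a + m) * sgn (int a) = int (n + b) * sgn (int b) \<longrightarrow>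
            (k' > 0 \<longrightarrow> nonsingleton_factors (n + m) Z) \<longrightarrow>
            (product \<longrightarrow> factors)))
   \<and> (k \<le> min n m \<longrightarrow>
       (let Z = concat_family n X Y; K = prod_kernel n m I L;
            product_SPD = SPD (n + m) Z (\<lambda>z z'. (-1) ^ k * K z z');
            factors = (\<exists>l\<in>{0, 1::nat}.
              SPD n X (\<lambda>x x'. (-1) ^ (k + l) * I x x') \<and>
              SPD m Y (\<lambda>y y'. (-1) ^ l * L y y'))
        in (product_SPD \<longleftrightarrow> factors) \<and>
           (product_SPD \<longrightarrow> SPDI k (n + m) Z K) \<and>
           ((k > 0 \<longrightarrow> nonsingleton_factors (n + m) Z) \<longrightarrow>
              (SPDI k (n + m) Z K \<longleftrightarrow> product_SPD))))"
proof -
  define Z where "Z = concat_family n X Y"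
  define K where "K = prod_kernel n m I L"
  have symK: "multi_symmetric (n + m) Z K"
    unfolding Z_def K_def using assms(6,7) by (rule multi_symmetric_prod_kernel)
  have sign: "((-1) ^ l :: real) \<in> {1, -1}" for l :: nat
    by (cases "even l") auto
  \<comment> \<open>\<open>p\<close> and \<open>q\<close> are the orders, \<open>c\<close> the sign
    of the product and \<open>s\<close> its free distribution over the factors. Each claim becomes a
    relation between \<open>Fac\<close> and \<open>Pos\<close>.\<close>
  define Fac where "Fac p q c \<longleftrightarrow> (\<exists>s\<in>{1, -1}.
      positive_on (measures_order p n X) (\<lambda>x x'. s * c * I x x') \<and>
      positive_on (measures_order q m Y) (\<lambda>y y'. s * L y y'))" for p q and c :: real
  define Pos where "Pos k c \<longleftrightarrow> positive_on (measures_order k (n + m) Z) (\<lambda>z z'. c * K z z')"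
    for k and c :: real
  have FacI: "Pos k c" if "Fac p q c" "p = 0 \<or> p + m \<le> k" "q = 0 \<or> n + q \<le> k" for p q k c
    using that positive_on_prod_kernel_signed[OF assms(6)] unfolding Fac_def Pos_def Z_def K_def
    by blast
  have Fac_iff: "Pos k ((-1) ^ l) \<longleftrightarrow> Fac (k - m) (k - n) ((-1) ^ l)"
    if "k \<le> n + m" "k > 0 \<longrightarrow> nonsingleton_factors (n + m) Z" for k l
    using factors_positive_on_iff[OF assms(1,2,6) that(1) sign that(2)[unfolded Z_def], of l]
    unfolding Fac_def Pos_def Z_def K_def by simp
  have ex_sign: "(\<exists>l\<in>{0, 1::nat}. P ((-1) ^ l)) \<longleftrightarrow> (\<exists>s\<in>{1, -1}. P s)" for P :: "real \<Rightarrow> bool"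
    by auto

  \<comment> \<open>The sign built into \<open>SPDI\<close> cancels \<open>(-1)^a'\<close> and
    \<open>(-1)^b'\<close>, leaving \<open>s = (-1)^l\<close> and \<open>c = (-1)^k\<close>.\<close>
  have fac1: "(\<exists>l\<in>{0, 1::nat}.
      SPDI a' n X (\<lambda>x x'. (-1) ^ (a' + k + l) * I x x') \<and>
      SPDI b' m Y (\<lambda>y y'. (-1) ^ (b' + l) * L y y')) \<longleftrightarrow> Fac a' b' ((-1) ^ k)" for a' b' k
  proof -
    have "(-1) ^ a' * (-1) ^ (a' + k + l) = ((-1) ^ l * (-1) ^ k :: real)"
      and "(-1) ^ b' * (-1) ^ (b' + l) = ((-1) ^ l :: real)" for l :: nat
      by (auto simp: power_add mult_ac simp flip: power_mult_distrib)
    then show ?thesis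
      unfolding SPDI_scale_iff[OF assms(6)] SPDI_scale_iff[OF assms(7)] Fac_def ex_sign[symmetric]
      by simp
  qed
  \<comment> \<open>Here the built-in signs remain: \<open>s = (-1)^(b + l)\<close> and
    \<open>s * c = (-1)^(a + l)\<close>, whence \<open>c = (-1)^(a + b)\<close>.\<close>
  have fac2: "(\<exists>l\<in>{0, 1::nat}.
      SPDI a n X (\<lambda>x x'. (-1) ^ l * I x x') \<and>
      SPDI b m Y (\<lambda>y y'. (-1) ^ l * L y y')) \<longleftrightarrow> Fac a b ((-1) ^ (a + b))"
    unfolding SPDI_scale_iff[OF assms(6)] SPDI_scale_iff[OF assms(7)] Fac_def
    by (cases "even a"; cases "even b") auto
  have fac3: "(\<exists>l\<in>{0, 1::nat}.
      SPD n X (\<lambda>x x'. (-1) ^ (k + l) * I x x') \<and>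
      SPD m Y (\<lambda>y y'. (-1) ^ l * L y y')) \<longleftrightarrow> Fac 0 0 ((-1) ^ k)"
    unfolding SPD_iff_positive_on Fac_def by (auto simp: power_add)
  have prod1: "SPDI k (n + m) Z K \<longleftrightarrow> Pos k ((-1) ^ k)" for k
    unfolding Pos_def using symK by (rule SPDI_iff_positive_on)
  have prod2: "SPDI k' (n + m) Z (\<lambda>z z'. (-1) ^ (k' + a + b) * K z z') \<longleftrightarrow> Pos k' ((-1) ^ (a + b))"
    for k'
  proof -
    have "(-1) ^ k' * (-1) ^ (k' + a + b) = ((-1) ^ (a + b) :: real)"
      by (auto simp: power_add mult_ac simp flip: power_mult_distrib)
    then show ?thesis
      unfolding SPDI_scale_iff[OF symK] Pos_def by simp
  qed
  have prod3: "SPD (n + m) Z (\<lambda>z z'. (-1) ^ k * K z z') \<longleftrightarrow> Pos 0 ((-1) ^ k)"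
    unfolding SPD_iff_positive_on Pos_def ..

  \<comment> \<open>The least order at which both slice conditions hold; \<open>sgn\<close> drops
    the requirement of a factor of order 0.\<close>
  define k' where "k' = nat (max (int (a + m) * sgn (int a)) (int (n + b) * sgn (int b)))"
  have k'_ge: "a = 0 \<or> a + m \<le> k'" "b = 0 \<or> n + b \<le> k'"
    by (auto simp: k'_def sgn_if)
  have "k' \<le> n + m"
    using assms(3,4) by (auto simp: k'_def sgn_if)
  \<comment> \<open>Equality leaves two cases: \<open>a = b = 0\<close> with \<open>k' = 0\<close>,
    or \<open>a + m = n + b = k'\<close>. Either way truncated subtraction recovers \<open>a\<close>
    and \<open>b\<close>, so the equivalence applies at \<open>k'\<close>.\<close>
  have k'_eq: "k' - m = a \<and> k' - n = b"
    if "int (a + m) * sgn (int a) = int (n + b) * sgn (int b)"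
    using that by (auto simp: k'_def sgn_if split: if_splits)
  have diff_eq: "nat (max (int k - int i) 0) = k - i" for i
    by auto

  have "(Fac (k - m) (k - n) ((-1) ^ k) \<longrightarrow> Pos k ((-1) ^ k)) \<and>
      ((k > 0 \<longrightarrow> nonsingleton_factors (n + m) Z) \<longrightarrow>
        (Pos k ((-1) ^ k) \<longleftrightarrow> Fac (k - m) (k - n) ((-1) ^ k)))"
  proof -
    have "k - m = 0 \<or> k - m + m \<le> k" "k - n = 0 \<or> n + (k - n) \<le> k"
      by linarith+
    then show ?thesis
      using Fac_iff[OF assms(5)] FacI by blast
  qed
  moreover have "(Fac a b ((-1) ^ (a + b)) \<longrightarrow> Pos k' ((-1) ^ (a + b))) \<and>
      (int (a + m) * sgn (int a) = int (n + b) * sgn (int b) \<longrightarrow>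
        (k' > 0 \<longrightarrow> nonsingleton_factors (n + m) Z) \<longrightarrow>
        (Pos k' ((-1) ^ (a + b)) \<longrightarrow> Fac a b ((-1) ^ (a + b))))"
    using Fac_iff[OF \<open>k' \<le> n + m\<close>, of "a + b"] FacI[OF _ k'_ge] k'_eq by auto
  moreover have "(Pos 0 ((-1) ^ k) \<longleftrightarrow> Fac 0 0 ((-1) ^ k)) \<and>
      (Pos 0 ((-1) ^ k) \<longrightarrow> Pos k ((-1) ^ k)) \<and>
      ((k > 0 \<longrightarrow> nonsingleton_factors (n + m) Z) \<longrightarrow>
        (Pos k ((-1) ^ k) \<longleftrightarrow> Pos 0 ((-1) ^ k)))" if "k \<le> min n m"
    \<comment> \<open>For \<open>k \<le> min n m\<close> both truncated orders are 0, so orders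
      \<open>k\<close> and 0 on the product give the same condition on the factors.\<close>
    using Fac_iff[of 0 k] Fac_iff[of k k] FacI[of 0 0 _ k] that by auto
  ultimately show ?thesis
    unfolding Let_def Z_def[symmetric] K_def[symmetric] k'_def[symmetric] diff_eq
      fac1 fac2 fac3 prod1 prod2 prod3
    by blast
qed

end
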